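(* Let $T\in\mathbb{B}(\mathcal{H})$ be a bounded linear operator on a complex Hilbert space $\mathcal{H}$ and let $\lambda\in[0,1]$. Then $$2\sqrt{\lambda-\lambda^2}\,\|\widetilde{T}\|\le \|M_\lambda(T)\|\le \lambda\|T\|+(1-\lambda)\|T^D\|.$$ In particular, $$2\sqrt{\lambda-\lambda^2}\,r(T)\le \|M_\lambda(T)\|\le\|T\|.$$
   Context: $\mathbb{B}(\mathcal{H})$ is the algebra of bounded linear operators on the complex Hilbert space $\mathcal{H}$, $\|\cdot\|$ the operator norm, and $r(T)$ the spectral radius. $T=U|T|$ denotes the canonical polar decomposition: $|T|=(T^*T)^{1/2}$ and $U$ is the unique partial isometry with $T=U|T|$ and $\mathcal{N}(U)=\mathcal{N}(T)$ (null spaces). The Duggal transform of $T$ is $T^D:=|T|U$; the Aluthge transform of $T$ is $\widetilde{T}:=|T|^{1/2}U|T|^{1/2}$. For $\lambda\in[0,1]$ the $\lambda$-mean transform of $T$ is $M_\lambda(T):=\lambda T+(1-\lambda)T^D$. *)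

theory Defs
  imports "HOL-Analysis.Analysis"
begin

class complex_vector = real_vector +
  fixes scaleC :: "complex \<Rightarrow> 'a \<Rightarrow> 'a"  (infixr \<open>*\<^sub>C\<close> 75)
  assumes scaleC_add_right: "a *\<^sub>C (x + y) = a *\<^sub>C x + a *\<^sub>C y"
    and scaleC_add_left: "(a + b) *\<^sub>C x = a *\<^sub>C x + b *\<^sub>C x"
    and scaleC_scaleC: "a *\<^sub>C (b *\<^sub>C x) = (a * b) *\<^sub>C x"
    and scaleC_one: "1 *\<^sub>C x = x"
    and scaleR_scaleC: "r *\<^sub>R x = complex_of_real r *\<^sub>C x"

text \<open>
  The complex inner product is linear in its first argument. The real inner product inherited
  from \<^class>\<open>real_inner\<close> is required to be its real part. Since \<open>cinner x x\<close> is real by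
  conjugate symmetry, this makes \<open>cinner\<close> positive definite, and makes the norm of
  \<^class>\<open>real_inner\<close> the norm induced by \<open>cinner\<close>.
\<close>

class complex_inner = complex_vector + real_inner +
  fixes cinner :: "'a \<Rightarrow> 'a \<Rightarrow> complex"
  assumes cinner_commute: "cinner x y = cnj (cinner y x)"
    and cinner_add_left: "cinner (x + y) z = cinner x z + cinner y z"
    and cinner_scaleC_left: "cinner (a *\<^sub>C x) y = a * cinner x y"
    and inner_eq_Re_cinner: "x \<bullet> y = Re (cinner x y)"

class chilbert_space = complex_inner + complete_space

instantiation complex :: chilbert_space
begin

definition scaleC_complex :: "complex \<Rightarrow> complex \<Rightarrow> complex"
  where "scaleC_complex a x = a * x"

definition cinner_complex :: "complex \<Rightarrow> complex \<Rightarrow> complex"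
  where "cinner_complex x y = x * cnj y"

instance
  by standard
    (auto simp: scaleC_complex_def cinner_complex_def inner_complex_def scaleR_conv_of_real
      algebra_simps)

end

text \<open>
  Operators are functions satisfying \<open>bounded_clinear\<close>; the operator norm is \<^const>\<open>onorm\<close>.
  Definite descriptions below are meaningful for arguments satisfying \<open>bounded_clinear\<close>
  (for \<open>sqrt_op\<close>, \<open>positive_op\<close>).
\<close>

definition bounded_clinear :: "('a::complex_inner \<Rightarrow> 'b::complex_inner) \<Rightarrow> bool"
  where "bounded_clinear T \<longleftrightarrow> bounded_linear T \<and> (\<forall>c x. T (c *\<^sub>C x) = c *\<^sub>C T x)"

definition cadjoint :: "('a::chilbert_space \<Rightarrow> 'b::chilbert_space) \<Rightarrow> 'b \<Rightarrow> 'a"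
  where "cadjoint T = (THE S. \<forall>x y. cinner (T x) y = cinner x (S y))"

definition positive_op :: "('a::chilbert_space \<Rightarrow> 'a) \<Rightarrow> bool"
  where "positive_op A \<longleftrightarrow> bounded_clinear A \<and> (\<forall>x. cinner (A x) x \<in> \<real>\<^sub>\<ge>\<^sub>0)"

definition sqrt_op :: "('a::chilbert_space \<Rightarrow> 'a) \<Rightarrow> 'a \<Rightarrow> 'a"
  where "sqrt_op A = (THE B. positive_op B \<and> B \<circ> B = A)"

definition abs_op :: "('a::chilbert_space \<Rightarrow> 'a) \<Rightarrow> 'a \<Rightarrow> 'a"
  where "abs_op T = sqrt_op (cadjoint T \<circ> T)"

definition null_space :: "('a::chilbert_space \<Rightarrow> 'b::chilbert_space) \<Rightarrow> 'a set"
  where "null_space T = {x. T x = 0}"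

definition partial_isometry :: "('a::chilbert_space \<Rightarrow> 'b::chilbert_space) \<Rightarrow> bool"
  where "partial_isometry U \<longleftrightarrow> bounded_clinear U \<and>
    (\<forall>x. (\<forall>y\<in>null_space U. cinner x y = 0) \<longrightarrow> norm (U x) = norm x)"

definition polar_isometry :: "('a::chilbert_space \<Rightarrow> 'a) \<Rightarrow> 'a \<Rightarrow> 'a"
  where "polar_isometry T =
    (THE U. partial_isometry U \<and> T = U \<circ> abs_op T \<and> null_space U = null_space T)"

definition spectrum :: "('a::chilbert_space \<Rightarrow> 'a) \<Rightarrow> complex set"
  where "spectrum T = {z. \<not> (\<exists>S. bounded_clinear S \<and>
    S \<circ> (\<lambda>x. T x - z *\<^sub>C x) = id \<and> (\<lambda>x. T x - z *\<^sub>C x) \<circ> S = id)}"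

text \<open>
  The spectrum of a bounded operator is empty only on the zero space, where the spectral radius
  is taken to be 0.
\<close>

definition spectral_radius :: "('a::chilbert_space \<Rightarrow> 'a) \<Rightarrow> real"
  where "spectral_radius T = (if spectrum T = {} then 0 else (SUP z\<in>spectrum T. cmod z))"

definition duggal :: "('a::chilbert_space \<Rightarrow> 'a) \<Rightarrow> 'a \<Rightarrow> 'a"
  where "duggal T = abs_op T \<circ> polar_isometry T"

definition aluthge :: "('a::chilbert_space \<Rightarrow> 'a) \<Rightarrow> 'a \<Rightarrow> 'a"
  where "aluthge T = sqrt_op (abs_op T) \<circ> polar_isometry T \<circ> sqrt_op (abs_op T)"

definition mean_transform :: "real \<Rightarrow> ('a::chilbert_space \<Rightarrow> 'a) \<Rightarrow> 'a \<Rightarrow> 'a"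
  where "mean_transform l T = (\<lambda>x. l *\<^sub>R T x + (1 - l) *\<^sub>R duggal T x)"

end

theory Submission
  imports Defs
begin

text \<open>
  Write \<open>T = U R\<^sup>2\<close> with \<open>R = \<bar>T\<bar>\<^sup>1\<^sup>/\<^sup>2\<close>. Then \<open>M\<^sub>\<lambda>(T) = A\<^sup>2 U + U B\<^sup>2\<close> for
  \<open>A = \<surd>(1 - \<lambda>) R\<close> and \<open>B = \<surd>\<lambda> R\<close>, while \<open>A U B\<close> is \<open>\<surd>(\<lambda> - \<lambda>\<^sup>2)\<close> times the Aluthge
  transform \<open>R U R\<close>, so the lower bound is the operator inequality
  \<open>2 \<parallel>A X B\<parallel> \<le> \<parallel>A\<^sup>2 X + X B\<^sup>2\<parallel>\<close>. The spectral radius enters because \<open>(U R) R\<close> and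
  \<open>R (U R)\<close> have the same nonzero spectrum. The upper bounds are the triangle inequality
  and \<open>\<parallel>\<bar>T\<bar> U x\<parallel> = \<parallel>T U x\<parallel>\<close>.
\<close>

subsection \<open>Orthogonal projection and adjoints\<close>

text \<open>By the parallelogram law a sequence in \<open>S\<close> minimising the distance to
  \<open>x\<close> is Cauchy. Its limit is a nearest point, and varying that point along
  \<open>s\<close> forces orthogonality.\<close>

lemma orthogonal_projection_exists:
  fixes S :: "'a::{real_inner,complete_space} set"
  assumes S: "subspace S" "closed S"
  obtains p where "p \<in> S" "\<And>s. s \<in> S \<Longrightarrow> (x - p) \<bullet> s = 0"
proof -
  define d where "d = (INF s\<in>S. (norm (x - s))\<^sup>2)"
  have ne: "S \<noteq> {}"
    using S(1) subspace_0 by blast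
  have d_le: "d \<le> (norm (x - s))\<^sup>2" if "s \<in> S" for s
    unfolding d_def by (rule cINF_lower[OF _ that]) (auto intro!: bdd_belowI[of _ 0])
  have "\<exists>s\<in>S. (norm (x - s))\<^sup>2 < d + inverse (Suc n)" for n
  proof (rule ccontr)
    assume "\<not> ?thesis"
    then have "d + inverse (Suc n) \<le> d"
      unfolding d_def by (intro cINF_greatest[OF ne]) (auto simp: not_less d_def)
    then show False by (simp add: not_le)
  qed
  then obtain f where f: "\<And>n. f n \<in> S" "\<And>n. (norm (x - f n))\<^sup>2 < d + inverse (Suc n)"
    by metis
  \<comment> \<open>The midpoint of \<open>f m\<close> and \<open>f n\<close> lies in
    \<open>S\<close>, so its squared distance to \<open>x\<close> is at least \<open>d\<close>; the
    parallelogram law turns this into a bound on their mutual distance.\<close>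
  have dist_f: "(dist (f m) (f n))\<^sup>2 \<le> 2 * inverse (Suc m) + 2 * inverse (Suc n)" for m n
  proof -
    have "(1/2) *\<^sub>R (f m + f n) \<in> S"
      using S(1) f(1) by (simp add: subspace_add subspace_scale)
    from d_le[OF this] have "4 * d \<le> (norm (2 *\<^sub>R (x - (1/2) *\<^sub>R (f m + f n))))\<^sup>2"
      by (simp add: power_mult_distrib)
    also have "2 *\<^sub>R (x - (1/2) *\<^sub>R (f m + f n)) = (x - f m) + (x - f n)"
      by (simp add: algebra_simps scaleR_2)
    finally have "4 * d \<le> (norm ((x - f m) + (x - f n)))\<^sup>2" .
    moreover have "(norm ((x - f m) + (x - f n)))\<^sup>2 + (norm ((x - f m) - (x - f n)))\<^sup>2
        = 2 * (norm (x - f m))\<^sup>2 + 2 * (norm (x - f n))\<^sup>2"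
      by (simp add: power2_norm_eq_inner inner_add inner_diff inner_commute)
    moreover have "norm ((x - f m) - (x - f n)) = dist (f m) (f n)"
      by (simp add: dist_norm norm_minus_commute)
    ultimately show ?thesis
      using f(2)[of m] f(2)[of n] by (simp del: of_nat_Suc)
  qed
  have "Cauchy f"
  proof (rule metric_CauchyI)
    fix e :: real assume "e > 0"
    then obtain N where N: "inverse (Suc N) < e\<^sup>2 / 4"
      using reals_Archimedean[of "e\<^sup>2 / 4"] by auto
    have "dist (f m) (f n) < e" if "m \<ge> N" "n \<ge> N" for m n
    proof -
      have "inverse (real (Suc m)) \<le> inverse (Suc N)" "inverse (real (Suc n)) \<le> inverse (Suc N)"
        using that by (auto intro!: le_imp_inverse_le)
      with dist_f[of m n] N have "(dist (f m) (f n))\<^sup>2 < e\<^sup>2" by linarith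
      with \<open>e > 0\<close> show ?thesis
        by (simp add: power2_less_imp_less)
    qed
    then show "\<exists>M. \<forall>m\<ge>M. \<forall>n\<ge>M. dist (f m) (f n) < e" by blast
  qed
  then obtain p where p: "f \<longlonglongrightarrow> p"
    using Cauchy_convergent_iff convergent_def by blast
  have "p \<in> S"
    using S(2) f(1) p closed_sequentially by blast
  have "(\<lambda>n. (norm (x - f n))\<^sup>2) \<longlonglongrightarrow> (norm (x - p))\<^sup>2"
    by (intro tendsto_intros p)
  moreover have "(\<lambda>n. d + inverse (Suc n)) \<longlonglongrightarrow> d"
    using LIMSEQ_inverse_real_of_nat_add .
  ultimately have p_le: "(norm (x - p))\<^sup>2 \<le> d"
    by (rule LIMSEQ_le) (use f(2) less_imp_le in blast)
  have "(x - p) \<bullet> s = 0" if "s \<in> S" for s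
  proof (cases "s = 0")
    case False
    \<comment> \<open>This \<open>t\<close> minimises the squared norm of
      \<open>(x - p) - t *\<^sub>R s\<close>, a quadratic in \<open>t\<close>.\<close>
    define t where "t = ((x - p) \<bullet> s) / (s \<bullet> s)"
    have "p + t *\<^sub>R s \<in> S"
      using S(1) \<open>p \<in> S\<close> that by (simp add: subspace_add subspace_scale)
    from order_trans[OF p_le d_le[OF this]]
    have "(norm (x - p))\<^sup>2 \<le> (norm ((x - p) - t *\<^sub>R s))\<^sup>2"
      by (simp only: diff_diff_eq)
    also have "\<dots> = (norm (x - p))\<^sup>2 - 2 * t * ((x - p) \<bullet> s) + t * t * (s \<bullet> s)"
      unfolding power2_norm_eq_inner by (simp add: inner_diff inner_commute algebra_simps)
    also have "t * t * (s \<bullet> s) = t * ((x - p) \<bullet> s)"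
      using False by (simp add: t_def)
    finally have "t * ((x - p) \<bullet> s) \<le> 0" by simp
    then have "((x - p) \<bullet> s)\<^sup>2 / (s \<bullet> s) \<le> 0"
      by (simp add: t_def power2_eq_square)
    moreover have "s \<bullet> s > 0" using False by simp
    ultimately show ?thesis
      by (metis divide_le_0_iff not_le power2_less_eq_zero_iff)
  qed simp
  with \<open>p \<in> S\<close> that show ?thesis by blast
qed

text \<open>For nonzero \<open>f\<close>, the component \<open>w\<close> of some \<open>x0\<close>
  orthogonal to the kernel represents \<open>f\<close> up to a scalar: subtracting a suitable
  multiple of \<open>w\<close> moves any \<open>x\<close> into the kernel.\<close>

lemma riesz_representation:
  fixes f :: "'a::{real_inner,complete_space} \<Rightarrow> real"
  assumes "bounded_linear f"
  obtains z where "\<And>x. f x = x \<bullet> z"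
proof (cases "\<forall>x. f x = 0")
  case False
  interpret bounded_linear f by fact
  obtain x0 where x0: "f x0 \<noteq> 0" using False by blast
  have "subspace {x. f x = 0}"
    by (auto simp: subspace_def add scaleR zero)
  moreover have "closed {x. f x = 0}"
    by (intro closed_Collect_eq continuous_on continuous_on_const continuous_on_id)
  ultimately obtain p where p: "f p = 0" "\<And>s. f s = 0 \<Longrightarrow> (x0 - p) \<bullet> s = 0"
    using orthogonal_projection_exists[of "{x. f x = 0}" x0] by auto
  define w where "w = x0 - p"
  have fw: "f w \<noteq> 0" using x0 p(1) by (simp add: w_def diff)
  then have w0: "w \<noteq> 0" using zero by auto
  have "f x = x \<bullet> ((f w / (w \<bullet> w)) *\<^sub>R w)" for x
  proof -
    have "f (x - (f x / f w) *\<^sub>R w) = 0" using fw by (simp add: diff scaleR)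
    then have "w \<bullet> (x - (f x / f w) *\<^sub>R w) = 0" using p(2) by (simp add: w_def)
    then have "w \<bullet> x = (f x / f w) * (w \<bullet> w)" by (simp add: inner_diff)
    then show ?thesis using fw w0 by (simp add: inner_commute)
  qed
  with that show ?thesis by blast
qed (use that[of 0] in auto)

lemma adjoint_exists:
  fixes T :: "'a::{real_inner,complete_space} \<Rightarrow> 'b::real_inner"
  assumes "bounded_linear T"
  obtains S where "bounded_linear S" "\<And>x y. T x \<bullet> y = x \<bullet> S y"
proof -
  interpret T: bounded_linear T by fact
  have "\<exists>z. \<forall>x. T x \<bullet> y = x \<bullet> z" for y
    by (rule riesz_representation[of "\<lambda>x. T x \<bullet> y"])
      (auto intro: bounded_linear_compose[OF bounded_linear_inner_left assms])
  then obtain S where S: "\<And>x y. T x \<bullet> y = x \<bullet> S y"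
    by metis
  have "bounded_linear S"
  proof (rule bounded_linear_intro)
    show "S (x + y) = S x + S y" for x y
      by (subst vector_eq_ldot[symmetric]) (simp add: S[symmetric] inner_add)
    show "S (r *\<^sub>R x) = r *\<^sub>R S x" for r x
      by (subst vector_eq_ldot[symmetric]) (simp add: S[symmetric])
    show "norm (S y) \<le> norm y * onorm T" for y
    proof (cases "S y = 0")
      case False
      have "norm (S y) * norm (S y) = T (S y) \<bullet> y"
        by (simp add: S dot_square_norm power2_eq_square)
      also have "\<dots> \<le> norm (T (S y)) * norm y"
        by (rule norm_cauchy_schwarz)
      also have "\<dots> \<le> (onorm T * norm (S y)) * norm y"
        by (intro mult_right_mono onorm assms) simp
      finally have "norm (S y) * norm (S y) \<le> (norm y * onorm T) * norm (S y)"
        by (simp add: ac_simps)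
      with False show ?thesis by simp
    qed (use onorm_pos_le[OF assms] in simp)
  qed
  with S that show ?thesis by blast
qed

subsection \<open>Positive operators and their square roots\<close>

text \<open>Positivity for real inner product spaces. Symmetry is demanded explicitly because a
  nonnegative real quadratic form does not force it; \<open>positive_op_iff_psd_op\<close> links
  this to the complex notion.\<close>

definition psd_op :: "('a::real_inner \<Rightarrow> 'a) \<Rightarrow> bool"
  where "psd_op A \<longleftrightarrow> bounded_linear A \<and> (\<forall>x y. A x \<bullet> y = x \<bullet> A y) \<and> (\<forall>x. 0 \<le> A x \<bullet> x)"

lemma psd_opD:
  assumes "psd_op A"
  shows "bounded_linear A" "A x \<bullet> y = x \<bullet> A y" "0 \<le> A x \<bullet> x"
  using assms by (auto simp: psd_op_def)

lemma psd_op_scaleR: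
  assumes "psd_op A" "0 \<le> c"
  shows "psd_op (\<lambda>x. c *\<^sub>R A x)"
  using assms by (auto simp: psd_op_def bounded_linear_const_scaleR)

text \<open>Positivity at \<open>x - A x\<close> gives ||A x||^2 <= <A x, x>, and then ||x - A x||^2
  = ||x||^2 - 2 <A x, x> + ||A x||^2 <= ||x||^2. This bounds the starting operator of the square
  root iteration.\<close>

lemma psd_contraction_complement:
  assumes A: "psd_op A" and le1: "\<And>x. norm (A x) \<le> norm x"
  shows "norm (x - A x) \<le> norm x"
proof -
  interpret bounded_linear A using A by (rule psd_opD)
  have "0 \<le> A (x - A x) \<bullet> (x - A x)"
    using A by (rule psd_opD)
  also have "\<dots> = A x \<bullet> x - 2 * (A x \<bullet> A x) + A (A x) \<bullet> A x"
    by (simp add: diff inner_diff psd_opD(2)[OF A, of "A x" x])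
  also have "A (A x) \<bullet> A x \<le> norm (A x) * norm (A x)"
    by (rule order_trans[OF norm_cauchy_schwarz mult_right_mono]) (auto intro: le1)
  also have "\<dots> = A x \<bullet> A x"
    by (simp add: dot_square_norm power2_eq_square)
  finally have "A x \<bullet> A x \<le> A x \<bullet> x" by simp
  then have "(norm (x - A x))\<^sup>2 \<le> (norm x)\<^sup>2"
    using psd_opD(3)[OF A, of x] unfolding power2_norm_eq_inner
    by (simp add: inner_diff inner_commute)
  then show ?thesis by simp
qed

text \<open>
  Newton-type iteration \<open>Y \<mapsto> (C + Y\<^sup>2) / 2\<close> with \<open>C = 1 - A\<close>: the increments of the
  operator iteration are majorised by those of the scalar iteration with \<open>C\<close> replaced by 1.
  A fixed point \<open>Z\<close> satisfies \<open>(1 - Z)\<^sup>2 = A\<close>.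
\<close>

lemma psd_contraction_sqrt_exists:
  fixes A :: "'a::{real_inner,banach} \<Rightarrow> 'a"
  assumes A: "psd_op A" and le1: "\<And>x. norm (A x) \<le> norm x"
  obtains B where "psd_op B" "\<And>x. B (B x) = A x"
    "\<And>D x. bounded_linear D \<Longrightarrow> (\<And>x. D (A x) = A (D x)) \<Longrightarrow> D (B x) = B (D x)"
proof -
  define C where "C = id_blinfun - Blinfun A"
  have C: "C x = x - A x" for x
    by (simp add: C_def blinfun.diff_left bounded_linear_Blinfun_apply psd_opD(1)[OF A])
  have norm_C: "norm C \<le> 1"
    by (rule norm_blinfun_bound) (simp_all add: C psd_contraction_complement[OF A le1])
  define Y where "Y = rec_nat 0 (\<lambda>_ Z. (1/2) *\<^sub>R (C + (Z o\<^sub>L Z)))"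
  define y :: "nat \<Rightarrow> real" where "y = rec_nat 0 (\<lambda>_ t. (1 + t * t) / 2)"
  have Y0: "Y 0 = 0" and YS: "Y (Suc n) = (1/2) *\<^sub>R (C + (Y n o\<^sub>L Y n))" for n
    by (simp_all add: Y_def)
  have y0: "y 0 = 0" and yS: "y (Suc n) = (1 + y n * y n) / 2" for n
    by (simp_all add: y_def)
  have y_bounds: "0 \<le> y n" "y n \<le> 1" for n
  proof (induction n)
    case (Suc n)
    { case 1 show ?case using Suc by (simp add: yS) }
    { case 2 show ?case using Suc mult_le_one[of "y n" "y n"] by (simp add: yS) }
  qed (simp_all add: y0)
  have "y n \<le> y (Suc n)" for n
    using zero_le_square[of "1 - y n"] by (simp add: yS algebra_simps)
  then have y_mono: "y m \<le> y n" if "m \<le> n" for m n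
    using lift_Suc_mono_le that by blast
  have norm_Y: "norm (Y n) \<le> y n" for n
  proof (induction n)
    case (Suc n)
    have "norm (Y n o\<^sub>L Y n) \<le> y n * y n"
      by (rule order_trans[OF norm_blinfun_compose mult_mono]) (auto intro: Suc y_bounds)
    then show ?case
      using norm_C norm_triangle_ineq[of C "Y n o\<^sub>L Y n"] by (simp add: YS yS)
  qed (simp add: Y0 y0)
  \<comment> \<open>Each iterate is a polynomial in \<open>C\<close>. The claim covers arbitrary
    \<open>D\<close> because it is applied both to other iterates and, in the limit, to operators
    commuting with \<open>A\<close>.\<close>
  have Y_comm: "D (Y n x) = Y n (D x)"
    if "bounded_linear D" "\<And>x. D (C x) = C (D x)" for D n x
  proof -
    interpret D: bounded_linear D by fact
    show ?thesis
      by (induction n arbitrary: x)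
        (simp_all add: Y0 YS D.zero D.add D.scaleR blinfun.add_left blinfun.scaleR_left that(2))
  qed
  have Y_Y: "Y m (Y n x) = Y n (Y m x)" for m n x
    by (rule Y_comm) (simp_all add: Y_comm blinfun.bounded_linear_right)
  have diff_Suc: "norm (Y (Suc n) - Y n) \<le> y (Suc n) - y n" for n
  proof (induction n)
    case (Suc n)
    \<comment> \<open>The iterates commute, so the difference of their squares factors.\<close>
    have "Y (Suc (Suc n)) - Y (Suc n)
        = (1/2) *\<^sub>R ((Y (Suc n) - Y n) o\<^sub>L (Y (Suc n) + Y n))" (is "_ = (1/2) *\<^sub>R ?P")
    proof (rule blinfun_eqI)
      fix x
      have "Y (Suc (Suc n)) x - Y (Suc n) x
          = (1/2) *\<^sub>R (Y (Suc n) (Y (Suc n) x) - Y n (Y n x))"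
        by (subst (1 2) YS) (simp add: blinfun.add_left blinfun.scaleR_left algebra_simps)
      then show "(Y (Suc (Suc n)) - Y (Suc n)) x = ((1/2) *\<^sub>R ?P) x"
        by (simp add: blinfun.bilinear_simps Y_Y[of n "Suc n"])
    qed
    then have "norm (Y (Suc (Suc n)) - Y (Suc n)) = norm ?P / 2"
      by simp
    moreover have "norm ?P \<le> (y (Suc n) - y n) * (y (Suc n) + y n)"
      by (intro order_trans[OF norm_blinfun_compose] mult_mono Suc
          order_trans[OF norm_triangle_ineq] add_mono norm_Y)
        (auto simp: y_mono)
    ultimately show ?case
      by (simp add: yS[of "Suc n"] yS[of n] field_simps)
  qed (use norm_C in \<open>simp add: Y0 y0 YS yS\<close>)
  have diff: "norm (Y (n + k) - Y n) \<le> y (n + k) - y n" for n k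
  proof (induction k)
    case (Suc k)
    then show ?case
      using diff_Suc[of "n + k"] norm_triangle_ineq[of "Y (Suc (n + k)) - Y (n + k)" "Y (n + k) - Y n"]
      by simp
  qed simp
  have "convergent y"
    by (rule Bseq_monoseq_convergent)
      (use y_bounds y_mono in \<open>auto intro!: BseqI'[of _ 1] simp: monoseq_def\<close>)
  then have "Cauchy y"
    by (simp add: Cauchy_convergent_iff)
  have "Cauchy Y"
  proof (rule CauchyI')
    fix e :: real assume "e > 0"
    then obtain N where N: "\<And>m n. N \<le> m \<Longrightarrow> N \<le> n \<Longrightarrow> norm (y m - y n) < e"
      using CauchyD[OF \<open>Cauchy y\<close>] by blast
    have "norm (Y m - Y n) < e" if "m \<ge> N" "n > m" for m n
      using diff[of m "n - m"] N[of n m] that by (simp add: norm_minus_commute)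
    then show "\<exists>M. \<forall>m\<ge>M. \<forall>n>m. dist (Y m) (Y n) < e"
      unfolding dist_norm by blast
  qed
  then obtain Z where Z: "Y \<longlonglongrightarrow> Z"
    using Cauchy_convergent_iff convergent_def by blast
  then have Zx: "(\<lambda>n. Y n x) \<longlonglongrightarrow> Z x" for x
    by (intro tendsto_intros)
  have "(\<lambda>n. (1/2) *\<^sub>R (C + (Y n o\<^sub>L Y n))) \<longlonglongrightarrow> (1/2) *\<^sub>R (C + (Z o\<^sub>L Z))"
    by (intro tendsto_intros bounded_bilinear.tendsto[OF bounded_bilinear_blinfun_compose] Z)
  then have "(\<lambda>n. Y (Suc n)) \<longlonglongrightarrow> (1/2) *\<^sub>R (C + (Z o\<^sub>L Z))"
    by (simp add: YS)
  then have "Z = (1/2) *\<^sub>R (C + (Z o\<^sub>L Z))"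
    using LIMSEQ_Suc[OF Z] LIMSEQ_unique by blast
  then have "Z x = ((1/2) *\<^sub>R (C + (Z o\<^sub>L Z))) x" for x
    by (rule arg_cong[where f = "\<lambda>W. blinfun_apply W x"])
  note Z_eq = this
  have Z_fix: "2 *\<^sub>R Z x = x - A x + Z (Z x)" for x
    by (subst (1) Z_eq) (simp add: blinfun.add_left blinfun.scaleR_left C)
  have "norm (Y n) \<le> 1" for n
    using norm_Y[of n] y_bounds(2)[of n] by linarith
  then have norm_Z: "norm Z \<le> 1"
    by (intro LIMSEQ_le_const2[OF tendsto_norm[OF Z]]) auto
  have Y_sym: "Y n x \<bullet> w = x \<bullet> Y n w" for n x w
    by (induction n arbitrary: x w)
      (simp_all add: Y0 YS blinfun.add_left blinfun.scaleR_left inner_add C inner_diff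
        psd_opD(2)[OF A])
  have Z_sym: "Z x \<bullet> w = x \<bullet> Z w" for x w
  proof (rule LIMSEQ_unique)
    show "(\<lambda>n. Y n x \<bullet> w) \<longlonglongrightarrow> Z x \<bullet> w" by (intro tendsto_intros Zx)
    show "(\<lambda>n. Y n x \<bullet> w) \<longlonglongrightarrow> x \<bullet> Z w" unfolding Y_sym by (intro tendsto_intros Zx)
  qed
  define B where "B = (\<lambda>x. x - Z x)"
  have "psd_op B"
    unfolding psd_op_def B_def
  proof (intro conjI allI)
    show "bounded_linear (\<lambda>x. x - Z x)"
      by (intro bounded_linear_sub bounded_linear_ident blinfun.bounded_linear_right)
    show "(x - Z x) \<bullet> w = x \<bullet> (w - Z w)" for x w
      by (simp add: inner_diff Z_sym)
    \<comment> \<open>Since \<open>norm Z\<close> is at most 1, <Z x, x> <= ||x||^2, which is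
      positivity of \<open>B\<close>.\<close>
    have "Z x \<bullet> x \<le> (1 * norm x) * norm x" for x
      by (intro order_trans[OF norm_cauchy_schwarz] mult_right_mono
          order_trans[OF norm_blinfun] norm_Z) auto
    then show "0 \<le> (x - Z x) \<bullet> x" for x
      by (simp add: inner_diff dot_square_norm power2_eq_square)
  qed
  moreover have "B (B x) = A x" for x
    using Z_fix[of x] by (simp add: B_def blinfun.diff_right scaleR_2 algebra_simps)
  moreover have "D (B x) = B (D x)"
    if D: "bounded_linear D" and DA: "\<And>x. D (A x) = A (D x)" for D x
  proof -
    interpret D: bounded_linear D by fact
    have DC: "D (C x) = C (D x)" for x by (simp add: C D.diff DA)
    have "(\<lambda>n. D (Y n x)) \<longlonglongrightarrow> D (Z x)" by (intro D.tendsto Zx)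
    then have "(\<lambda>n. Y n (D x)) \<longlonglongrightarrow> D (Z x)" by (simp add: Y_comm[OF D DC])
    then have "D (Z x) = Z (D x)" using Zx LIMSEQ_unique by blast
    then show ?thesis by (simp add: B_def D.diff)
  qed
  ultimately show ?thesis using that by blast
qed

text \<open>Reduction to contractions by dividing by \<open>c\<close> and multiplying the root by
  \<open>sqrt c\<close>. The summand 1 in \<open>c\<close> keeps it positive when \<open>A\<close>
  is zero.\<close>

lemma psd_sqrt_exists:
  fixes A :: "'a::{real_inner,banach} \<Rightarrow> 'a"
  assumes A: "psd_op A"
  obtains B where "psd_op B" "\<And>x. B (B x) = A x"
    "\<And>D x. bounded_linear D \<Longrightarrow> (\<And>x. D (A x) = A (D x)) \<Longrightarrow> D (B x) = B (D x)"
proof -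
  define c where "c = onorm A + 1"
  have c: "c > 0"
    using onorm_pos_le[OF psd_opD(1)[OF A]] by (simp add: c_def)
  have "norm (inverse c *\<^sub>R A x) \<le> norm x" for x
  proof -
    have "norm (A x) \<le> onorm A * norm x" using A by (intro onorm psd_opD)
    also have "\<dots> \<le> c * norm x" by (simp add: c_def mult_right_mono)
    finally show ?thesis using c by (simp add: field_simps)
  qed
  then obtain B where B: "psd_op B" "\<And>x. B (B x) = inverse c *\<^sub>R A x"
    "\<And>D x. bounded_linear D \<Longrightarrow> (\<And>x. D (inverse c *\<^sub>R A x) = inverse c *\<^sub>R A (D x))
      \<Longrightarrow> D (B x) = B (D x)"
    using psd_contraction_sqrt_exists[of "\<lambda>x. inverse c *\<^sub>R A x"] psd_op_scaleR[OF A] c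
    by (metis inverse_nonnegative_iff_nonnegative less_eq_real_def)
  interpret B: bounded_linear B using B(1) by (rule psd_opD)
  show ?thesis
  proof
    show "psd_op (\<lambda>x. sqrt c *\<^sub>R B x)" using B(1) c by (intro psd_op_scaleR) auto
    show "sqrt c *\<^sub>R B (sqrt c *\<^sub>R B x) = A x" for x
      using c by (simp add: B.scaleR B(2) flip: mult.assoc)
    show "D (sqrt c *\<^sub>R B x) = sqrt c *\<^sub>R B (D x)"
      if D: "bounded_linear D" and "\<And>x. D (A x) = A (D x)" for D x
    proof -
      interpret D: bounded_linear D by fact
      show ?thesis using B(3)[OF D] that(2) by (simp add: D.scaleR)
    qed
  qed
qed

text \<open>With \<open>B\<close> a square root of \<open>A\<close>, <A x, x> = ||B x||^2.\<close>

lemma psd_inner_eq_0: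
  fixes A :: "'a::{real_inner,banach} \<Rightarrow> 'a"
  assumes A: "psd_op A" and "A x \<bullet> x = 0"
  shows "A x = 0"
proof -
  obtain B where B: "psd_op B" "\<And>x. B (B x) = A x"
    using psd_sqrt_exists[OF A] by metis
  interpret bounded_linear B using B(1) by (rule psd_opD)
  have "B x \<bullet> B x = 0" using assms(2) B(2) psd_opD(2)[OF B(1)] by (metis)
  then show ?thesis using B(2)[of x] by (simp add: zero)
qed

lemma psd_sqrt_unique:
  fixes A :: "'a::{real_inner,banach} \<Rightarrow> 'a"
  assumes E: "psd_op E" "\<And>x. E (E x) = A x" and F: "psd_op F" "\<And>x. F (F x) = A x"
  shows "E = F"
proof -
  have "psd_op A"
    unfolding psd_op_def
  proof (intro conjI allI)
    show "bounded_linear A"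
      using bounded_linear_compose[OF psd_opD(1)[OF E(1)] psd_opD(1)[OF E(1)]] E(2) by simp
    show "A x \<bullet> y = x \<bullet> A y" for x y
      by (metis E(2) psd_opD(2)[OF E(1)])
    show "0 \<le> A x \<bullet> x" for x
      by (metis E(2) psd_opD(2)[OF E(1)] inner_ge_zero)
  qed
  then obtain B where B: "psd_op B" "\<And>x. B (B x) = A x"
    "\<And>D x. bounded_linear D \<Longrightarrow> (\<And>x. D (A x) = A (D x)) \<Longrightarrow> D (B x) = B (D x)"
    using psd_sqrt_exists[OF \<open>psd_op A\<close>] by blast
  \<comment> \<open>Every root \<open>G\<close> commutes with \<open>A = G^2\<close>, hence with the
    constructed \<open>B\<close>. For \<open>y = (B - G) x\<close> this gives
    \<open>(B + G) y = 0\<close>; positivity yields \<open>B y = G y = 0\<close>, and then ||y||^2 =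
    <x, (B - G) y> = 0.\<close>
  have "B = G" if G: "psd_op G" "\<And>x. G (G x) = A x" for G
  proof
    fix x
    interpret B: bounded_linear B using B(1) by (rule psd_opD)
    interpret G: bounded_linear G using G(1) by (rule psd_opD)
    have GB: "G (B x) = B (G x)" for x
      by (rule B(3)) (simp_all add: G.bounded_linear_axioms flip: G(2))
    define y where "y = B x - G x"
    have "B y + G y = 0"
      by (simp add: y_def B.diff G.diff B(2) G(2) GB)
    then have "B y \<bullet> y + G y \<bullet> y = 0"
      by (metis inner_add_left inner_zero_left)
    moreover have "0 \<le> B y \<bullet> y" "0 \<le> G y \<bullet> y"
      using B(1) G(1) psd_opD(3) by blast+
    ultimately have "B y = 0" "G y = 0"
      using psd_inner_eq_0 B(1) G(1) by (smt (verit))+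
    then have "x \<bullet> (B y - G y) = 0" by simp
    then have "y \<bullet> y = 0"
      using psd_opD(2)[OF B(1), of x y] psd_opD(2)[OF G(1), of x y]
      by (subst (1) y_def) (simp add: inner_diff)
    then show "B x = G x" by (simp add: y_def)
  qed
  then show ?thesis using E F by metis
qed

subsection \<open>An arithmetic-geometric mean inequality for operators\<close>

text \<open>
  Let \<open>Y = A X B\<close> and \<open>s = \<parallel>Y\<parallel>\<close>. For a unit vector \<open>x\<close> almost attaining \<open>s\<close> put
  \<open>u = Y x / s\<close>, so that \<open>Y\<^sup>* u \<approx> s x\<close>. With \<open>y = B x\<close> and \<open>z = A u\<close>,
  \<open>\<langle>(A\<^sup>2 X + X B\<^sup>2) y, z\<rangle> \<approx> s (\<parallel>z\<parallel>\<^sup>2 + \<parallel>y\<parallel>\<^sup>2) \<ge> 2 s \<parallel>y\<parallel> \<parallel>z\<parallel>\<close>. The vector \<open>e\<close> is the error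
  \<open>Y\<^sup>* u - s x\<close>; to avoid limits the estimate is kept homogeneous in \<open>x\<close>.
\<close>

lemma operator_am_gm:
  fixes A B X :: "'a::{real_inner,complete_space} \<Rightarrow> 'a"
  assumes bl: "bounded_linear A" "bounded_linear B" "bounded_linear X"
    and A_sym: "\<And>x y. A x \<bullet> y = x \<bullet> A y" and B_sym: "\<And>x y. B x \<bullet> y = x \<bullet> B y"
  shows "2 * onorm (\<lambda>x. A (X (B x))) \<le> onorm (\<lambda>x. A (A (X x)) + X (B (B x)))"
proof (rule ccontr)
  define Y where "Y = (\<lambda>x. A (X (B x)))"
  define Q where "Q = (\<lambda>x. A (A (X x)) + X (B (B x)))"
  define s where "s = onorm Y"
  define c where "c = onorm (\<lambda>x. A (X x))"
  define b where "b = onorm B"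
  \<comment> \<open>Half the amount by which the inequality would fail, positive under the negated
    goal.\<close>
  define \<delta> where "\<delta> = s - onorm Q / 2"
  note comp = bounded_linear_compose
  have AX: "bounded_linear (\<lambda>x. A (X x))"
    by (intro comp[OF bl(1) bl(3)])
  have Y: "bounded_linear Y"
    unfolding Y_def by (intro comp[OF AX bl(2)])
  have Q: "bounded_linear Q"
    unfolding Q_def
    by (intro bounded_linear_add comp[OF bl(1) AX] comp[OF bl(3) comp[OF bl(2) bl(2)]])
  interpret A: bounded_linear A by fact
  interpret B: bounded_linear B by fact
  interpret X: bounded_linear X by fact
  obtain X' where X': "\<And>x y. X x \<bullet> y = x \<bullet> X' y"
    using adjoint_exists[OF bl(3)] by metis
  define Y' where "Y' = (\<lambda>x. B (X' (A x)))"
  have Y': "Y x \<bullet> y = x \<bullet> Y' y" for x y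
    by (simp add: Y_def Y'_def A_sym B_sym X')
  assume "\<not> ?thesis"
  then have "\<delta> > 0" by (simp add: \<delta>_def s_def Y_def Q_def)
  moreover have "onorm Q \<ge> 0" by (rule onorm_pos_le[OF Q])
  ultimately have "s > 0" by (simp add: \<delta>_def)
  have "c \<ge> 0" "b \<ge> 0"
    by (simp_all add: c_def b_def onorm_pos_le AX bl)
  have norm_Y': "norm (Y' u) \<le> s * norm u" for u
  proof (cases "Y' u = 0")
    case False
    have "norm (Y' u) * norm (Y' u) = Y (Y' u) \<bullet> u"
      by (simp add: Y' dot_square_norm power2_eq_square)
    also have "\<dots> \<le> (s * norm (Y' u)) * norm u"
      unfolding s_def by (intro order_trans[OF norm_cauchy_schwarz] mult_right_mono onorm Y) simp
    finally have "norm (Y' u) * norm (Y' u) \<le> (s * norm u) * norm (Y' u)"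
      by (simp add: ac_simps)
    with False show ?thesis by simp
  qed (use \<open>s > 0\<close> in simp)
  \<comment> \<open>This keeps ||Y x|| away from s ||x|| by a uniform factor: near equality would
    make the error \<open>e\<close> small, while the gap forces \<delta> ||Y x|| <= c b
    ||e||.\<close>
  have bound: "(\<delta>\<^sup>2 + (c * b)\<^sup>2) * (norm (Y x))\<^sup>2 \<le> (c * b)\<^sup>2 * (s * norm x)\<^sup>2" for x
  proof (cases "B x = 0")
    case True
    then have "norm (Y x) = 0"
      by (simp add: Y_def X.zero A.zero)
    then show ?thesis by simp
  next
    case False
    define u where "u = inverse s *\<^sub>R Y x"
    define y where "y = B x"
    define z where "z = A u"
    define e where "e = Y' u - s *\<^sub>R x"
    have Yx: "Y x = s *\<^sub>R u" using \<open>s > 0\<close> by (simp add: u_def)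
    have "norm (Y' u) \<le> norm (Y x)"
      using norm_Y'[of u] \<open>s > 0\<close> by (simp add: u_def flip: mult.assoc)
    then have "Y' u \<bullet> Y' u \<le> (norm (Y x))\<^sup>2"
      by (simp add: dot_square_norm)
    moreover have "s * (x \<bullet> Y' u) = (norm (Y x))\<^sup>2"
      unfolding Y'[symmetric] using \<open>s > 0\<close> by (simp add: u_def dot_square_norm)
    ultimately have e: "(norm e)\<^sup>2 \<le> (s * norm x)\<^sup>2 - (norm (Y x))\<^sup>2"
      unfolding e_def power2_norm_eq_inner
      by (simp add: inner_diff inner_commute power_mult_distrib power2_norm_eq_inner)
        (simp add: power2_eq_square)
    have Qy: "Q y \<bullet> z = s * (norm z)\<^sup>2 + (s * (norm y)\<^sup>2 + y \<bullet> B e)"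
    proof -
      have "A (A (X y)) = s *\<^sub>R z"
        using Yx by (simp add: y_def z_def A.scaleR[symmetric] Y_def)
      moreover have "X (B (B y)) \<bullet> z = y \<bullet> B (Y' u)"
        by (simp add: X' B_sym Y'_def z_def)
      moreover have "Y' u = s *\<^sub>R x + e" by (simp add: e_def)
      ultimately show ?thesis
        by (simp add: Q_def inner_add B.add B.scaleR power2_norm_eq_inner flip: y_def)
    qed
    have "\<bar>y \<bullet> B e\<bar> \<le> norm y * (b * norm e)"
      unfolding b_def
      by (intro order_trans[OF Cauchy_Schwarz_ineq2] mult_left_mono onorm bl) simp
    moreover have "Q y \<bullet> z \<le> (onorm Q * norm y) * norm z"
      by (intro order_trans[OF norm_cauchy_schwarz] mult_right_mono onorm Q) simp
    moreover have "onorm Q * (2 * (norm y * norm z)) \<le> onorm Q * ((norm y)\<^sup>2 + (norm z)\<^sup>2)"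
      by (intro mult_left_mono \<open>onorm Q \<ge> 0\<close>) (use sum_squares_bound[of "norm y" "norm z"] in simp)
    \<comment> \<open><Q y, z> is at most half of \<open>onorm Q\<close> times ||y||^2 + ||z||^2;
      subtracting this from the \<open>s\<close> terms in \<open>Qy\<close> leaves the coefficient
      \<delta>.\<close>
    ultimately have "\<delta> * (norm z)\<^sup>2 + \<delta> * (norm y)\<^sup>2 \<le> norm y * (b * norm e)"
      unfolding Qy \<delta>_def by (simp add: algebra_simps)
    moreover have "0 \<le> \<delta> * (norm z)\<^sup>2"
      using \<open>\<delta> > 0\<close> by simp
    ultimately have "norm y * (\<delta> * norm y) \<le> norm y * (b * norm e)"
      by (simp add: power2_eq_square ac_simps)
    then have "\<delta> * norm y \<le> b * norm e"
      using False by (simp add: y_def)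
    then have "c * (\<delta> * norm y) \<le> c * (b * norm e)"
      using \<open>c \<ge> 0\<close> by (rule mult_left_mono)
    moreover have "norm (Y x) \<le> c * norm y"
      unfolding Y_def c_def y_def by (rule onorm[OF AX])
    then have "\<delta> * norm (Y x) \<le> \<delta> * (c * norm y)"
      using \<open>\<delta> > 0\<close> by (intro mult_left_mono) auto
    ultimately have "\<delta> * norm (Y x) \<le> (c * b) * norm e"
      by (simp add: ac_simps)
    then have "(\<delta> * norm (Y x))\<^sup>2 \<le> ((c * b) * norm e)\<^sup>2"
      using \<open>\<delta> > 0\<close> by (intro power_mono) auto
    also have "\<dots> = (c * b)\<^sup>2 * (norm e)\<^sup>2" by (rule power_mult_distrib)
    also have "\<dots> \<le> (c * b)\<^sup>2 * ((s * norm x)\<^sup>2 - (norm (Y x))\<^sup>2)"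
      by (intro mult_left_mono e) simp
    finally show ?thesis by (simp add: power_mult_distrib algebra_simps)
  qed
  \<comment> \<open>The bound reads ||Y x||^2 <= q (s ||x||)^2 with q < 1, so \<open>onorm Y\<close>
    would be strictly below itself.\<close>
  define q where "q = (c * b)\<^sup>2 / (\<delta>\<^sup>2 + (c * b)\<^sup>2)"
  have pos: "\<delta>\<^sup>2 + (c * b)\<^sup>2 > 0"
    using \<open>\<delta> > 0\<close> by (simp add: add_pos_nonneg)
  then have q: "0 \<le> q" "q < 1"
    using \<open>\<delta> > 0\<close> by (simp_all add: q_def)
  have "norm (Y x) \<le> sqrt q * s * norm x" for x
  proof (rule power2_le_imp_le)
    show "(norm (Y x))\<^sup>2 \<le> (sqrt q * s * norm x)\<^sup>2"
      using bound[of x] pos q(1) by (simp add: power_mult_distrib) (simp add: q_def field_simps)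
  qed (use q \<open>s > 0\<close> in simp)
  then have "onorm Y \<le> sqrt q * s"
    using q \<open>s > 0\<close> by (intro onorm_bound) auto
  moreover have "sqrt q < 1" using q by simp
  ultimately show False using \<open>s > 0\<close> by (simp add: s_def)
qed

subsection \<open>Complex operators and the polar decomposition\<close>

instance chilbert_space \<subseteq> banach ..

lemma cinner_scaleC_right: "cinner x (a *\<^sub>C y) = cnj a * cinner x y"
  by (metis cinner_commute cinner_scaleC_left complex_cnj_mult)

text \<open>Transfers identities for the real inner product to the complex one, provided the maps
  involved respect multiplication by \<i>.\<close>

lemma cinner_conv_inner: "cinner x y = Complex (x \<bullet> y) (x \<bullet> (\<i> *\<^sub>C y))"
  by (simp add: complex_eq_iff inner_eq_Re_cinner cinner_scaleC_right)

lemma inner_scaleC_left: "(c *\<^sub>C x) \<bullet> y = (x::'a::complex_inner) \<bullet> (cnj c *\<^sub>C y)"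
  by (simp add: inner_eq_Re_cinner cinner_scaleC_left cinner_scaleC_right)

lemma norm_scaleC: "norm (c *\<^sub>C x) = cmod c * norm (x::'a::complex_inner)"
proof -
  have "cnj c *\<^sub>C c *\<^sub>C x = (cmod c)\<^sup>2 *\<^sub>R x"
    by (simp only: scaleC_scaleC scaleR_scaleC complex_norm_square mult.commute[of "cnj c"])
  then have "(norm (c *\<^sub>C x))\<^sup>2 = (cmod c * norm x)\<^sup>2"
    by (simp add: power2_norm_eq_inner inner_scaleC_left power_mult_distrib)
  then show ?thesis by (simp add: power2_eq_imp_eq)
qed

lemma bounded_linear_scaleC: "bounded_linear (\<lambda>x. c *\<^sub>C (x::'a::complex_inner))"
proof (rule bounded_linear_intro)
  show "c *\<^sub>C (r *\<^sub>R x) = r *\<^sub>R c *\<^sub>C x" for r and x :: 'a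
    by (simp add: scaleR_scaleC scaleC_scaleC mult.commute)
  show "norm (c *\<^sub>C x) \<le> norm x * cmod c" for x :: 'a
    by (simp add: norm_scaleC mult.commute)
qed (rule scaleC_add_right)

lemma scaleC_diff_right: "c *\<^sub>C (x - y) = c *\<^sub>C x - c *\<^sub>C (y::'a::complex_inner)"
  by (rule linear_diff[OF bounded_linear.linear[OF bounded_linear_scaleC]])

lemma bounded_clinearD:
  assumes "bounded_clinear T"
  shows "bounded_linear T" "T (c *\<^sub>C x) = c *\<^sub>C T x"
  using assms by (auto simp: bounded_clinear_def)

lemma bounded_clinear_compose:
  assumes "bounded_clinear S" "bounded_clinear T"
  shows "bounded_clinear (\<lambda>x. S (T x))"
  using assms by (auto simp: bounded_clinear_def intro: bounded_linear_compose)

lemma cadjoint_unique: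
  assumes "\<And>x y. cinner (T x) y = cinner x (S y)"
  shows "cadjoint T = S"
  unfolding cadjoint_def
proof (rule the_equality)
  show "S' = S" if S': "\<forall>x y. cinner (T x) y = cinner x (S' y)" for S'
  proof
    fix y
    have "cinner x (S' y) = cinner x (S y)" for x
      using S' assms by metis
    then have "x \<bullet> S' y = x \<bullet> S y" for x
      by (simp add: inner_eq_Re_cinner)
    then show "S' y = S y" using vector_eq_ldot by blast
  qed
qed (use assms in blast)

text \<open>The real adjoint inherits complex linearity from \<open>T\<close>, since moving a scalar
  across the real inner product conjugates it. It then satisfies the complex adjoint identity, so
  \<open>cadjoint_unique\<close> applies.\<close>

lemma
  assumes T: "bounded_clinear T"
  shows bounded_clinear_cadjoint: "bounded_clinear (cadjoint T)"
    and inner_cadjoint: "T x \<bullet> y = x \<bullet> cadjoint T y"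
proof -
  obtain S where S: "bounded_linear S" "\<And>x y. T x \<bullet> y = x \<bullet> S y"
    using adjoint_exists[OF bounded_clinearD(1)[OF T]] by metis
  have SC: "S (c *\<^sub>C y) = c *\<^sub>C S y" for c y
  proof (subst vector_eq_ldot[symmetric], rule allI)
    fix x
    have "x \<bullet> S (c *\<^sub>C y) = (cnj c *\<^sub>C T x) \<bullet> y"
      by (simp add: inner_scaleC_left flip: S(2))
    also have "\<dots> = x \<bullet> c *\<^sub>C S y"
      by (simp add: inner_scaleC_left S(2) flip: bounded_clinearD(2)[OF T])
    finally show "x \<bullet> S (c *\<^sub>C y) = x \<bullet> c *\<^sub>C S y" .
  qed
  have "cadjoint T = S"
    by (rule cadjoint_unique) (simp add: cinner_conv_inner S(2) SC)
  with S SC show "bounded_clinear (cadjoint T)" "T x \<bullet> y = x \<bullet> cadjoint T y"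
    by (auto simp: bounded_clinear_def)
qed

lemma positive_op_iff_psd_op: "positive_op A \<longleftrightarrow> bounded_clinear A \<and> psd_op A"
proof (cases "bounded_clinear A")
  case True
  note AC = bounded_clinearD(2)[OF True]
  interpret bounded_linear A using True by (rule bounded_clinearD)
  have im: "Im (cinner (A x) x) = A x \<bullet> \<i> *\<^sub>C x" and re: "Re (cinner (A x) x) = A x \<bullet> x" for x
    by (simp_all add: cinner_conv_inner)
  have i_left: "(\<i> *\<^sub>C x) \<bullet> y = - (x \<bullet> \<i> *\<^sub>C y)" for x y :: 'a
    by (simp add: inner_eq_Re_cinner cinner_scaleC_left cinner_scaleC_right)
  have ii: "\<i> *\<^sub>C \<i> *\<^sub>C x = - x" for x :: 'a
    using scaleR_scaleC[of "-1" x] by (simp add: scaleC_scaleC)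
  \<comment> \<open>The left side says that the complex quadratic form is real. Polarisation at
    \<open>x + \<i> *\<^sub>C y\<close> turns this into symmetry.\<close>
  have "(\<forall>x. A x \<bullet> \<i> *\<^sub>C x = 0) \<longleftrightarrow> (\<forall>x y. A x \<bullet> y = x \<bullet> A y)"
  proof safe
    fix x y
    assume *: "\<forall>x. A x \<bullet> \<i> *\<^sub>C x = 0"
    have "v \<bullet> \<i> *\<^sub>C A v = 0" for v
      using * i_left[of v "A v"] by (simp add: inner_commute)
    moreover have "A (x + \<i> *\<^sub>C y) \<bullet> \<i> *\<^sub>C (x + \<i> *\<^sub>C y) = 0" using * by blast
    ultimately show "A x \<bullet> y = x \<bullet> A y"
      using * by (simp add: add AC scaleC_add_right scaleC_diff_right
          inner_add inner_diff i_left ii inner_commute)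
  next
    fix x
    assume *: "\<forall>x y. A x \<bullet> y = x \<bullet> A y"
    have "A x \<bullet> \<i> *\<^sub>C x = x \<bullet> \<i> *\<^sub>C A x"
      using * by (simp flip: AC)
    also have "\<dots> = - (A x \<bullet> \<i> *\<^sub>C x)"
      by (metis i_left inner_commute)
    finally show "A x \<bullet> \<i> *\<^sub>C x = 0" by simp
  qed
  then show ?thesis
    using True bounded_linear_axioms
    by (auto simp: positive_op_def psd_op_def complex_nonneg_Reals_iff im re)
qed (simp add: positive_op_def)

lemma
  assumes A: "positive_op A"
  shows positive_op_sqrt_op: "positive_op (sqrt_op A)"
    and sqrt_op_sqrt_op: "sqrt_op A (sqrt_op A x) = A x"
proof -
  have psd: "psd_op A" and AC: "bounded_clinear A"
    using A by (auto simp: positive_op_iff_psd_op)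
  obtain B where B: "psd_op B" "\<And>x. B (B x) = A x"
    "\<And>D x. bounded_linear D \<Longrightarrow> (\<And>x. D (A x) = A (D x)) \<Longrightarrow> D (B x) = B (D x)"
    using psd_sqrt_exists[OF psd] by blast
  \<comment> \<open>Multiplication by \<open>c\<close> is a bounded real-linear map commuting with
    \<open>A\<close>, so the commutation property of the root makes \<open>B\<close> complex
    linear.\<close>
  have "c *\<^sub>C B x = B (c *\<^sub>C x)" for c x
    by (rule B(3)) (simp_all add: bounded_linear_scaleC bounded_clinearD(2)[OF AC])
  then have "positive_op B"
    using B(1) by (simp add: positive_op_iff_psd_op bounded_clinear_def psd_opD(1))
  have "sqrt_op A = B"
    unfolding sqrt_op_def
  proof (rule the_equality)
    show "positive_op B \<and> B \<circ> B = A" using \<open>positive_op B\<close> B(2) by auto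
    show "E = B" if E: "positive_op E \<and> E \<circ> E = A" for E
    proof (rule psd_sqrt_unique[where A = A])
      show "E (E x) = A x" for x using E by (metis comp_apply)
    qed (use E B in \<open>auto simp: positive_op_iff_psd_op\<close>)
  qed
  with \<open>positive_op B\<close> B(2) show "positive_op (sqrt_op A)" "sqrt_op A (sqrt_op A x) = A x"
    by auto
qed

lemma
  assumes T: "bounded_clinear T"
  shows positive_op_abs_op: "positive_op (abs_op T)"
    and norm_abs_op: "norm (abs_op T x) = norm (T x)"
proof -
  have adj: "cadjoint T (T x) \<bullet> y = T x \<bullet> T y" for x y
    by (metis inner_cadjoint[OF T] inner_commute)
  have "bounded_clinear (\<lambda>x. cadjoint T (T x))"
    by (rule bounded_clinear_compose[OF bounded_clinear_cadjoint[OF T] T])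
  then have pos: "positive_op (cadjoint T \<circ> T)"
    by (auto simp: positive_op_iff_psd_op psd_op_def adj comp_def bounded_clinearD(1)
        inner_cadjoint[OF T, symmetric])
  then show abs: "positive_op (abs_op T)"
    unfolding abs_op_def by (rule positive_op_sqrt_op)
  have "abs_op T x \<bullet> abs_op T x = abs_op T (abs_op T x) \<bullet> x"
    using abs by (simp add: positive_op_iff_psd_op psd_opD(2)[of "abs_op T" "abs_op T x"])
  also have "abs_op T (abs_op T x) = cadjoint T (T x)"
    using sqrt_op_sqrt_op[OF pos] by (simp add: abs_op_def)
  finally have "abs_op T x \<bullet> abs_op T x = T x \<bullet> T x"
    by (simp only: adj)
  then show "norm (abs_op T x) = norm (T x)"
    by (simp add: norm_eq)
qed

text \<open>
  The relation \<open>H y w\<close> is the graph of \<open>U\<close>: the component \<open>p\<close> of \<open>y\<close> in the closed range of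
  \<open>\<bar>T\<bar>\<close> is approximated by values \<open>\<bar>T\<bar> x\<^sub>n\<close>, and \<open>w = lim T x\<^sub>n\<close>.
\<close>

lemma
  fixes T :: "'a::chilbert_space \<Rightarrow> 'a"
  assumes T: "bounded_clinear T"
  shows bounded_clinear_polar_isometry: "bounded_clinear (polar_isometry T)"
    and polar_isometry_abs_op: "polar_isometry T (abs_op T x) = T x"
    and norm_polar_isometry_le: "norm (polar_isometry T x) \<le> norm x"
proof -
  define P where "P = abs_op T"
  have P: "positive_op P" and norm_P: "norm (P x) = norm (T x)" for x
    unfolding P_def using positive_op_abs_op[OF T] norm_abs_op[OF T] by auto
  then have PC: "bounded_clinear P" and P_sym: "P x \<bullet> y = x \<bullet> P y" for x y
    by (auto simp: positive_op_iff_psd_op psd_opD(2))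
  interpret T: bounded_linear T using T by (rule bounded_clinearD)
  interpret P: bounded_linear P using PC by (rule bounded_clinearD)
  have P_eq_0: "P x = 0 \<longleftrightarrow> T x = 0" for x
    using norm_P[of x] by (metis norm_eq_zero)
  \<comment> \<open>As \<open>P\<close> is symmetric, \<open>P (y - p) = 0\<close> expresses that
    \<open>y - p\<close> is orthogonal to the range of \<open>P\<close>.\<close>
  define H where "H = (\<lambda>y w. \<exists>f p. (\<lambda>n. P (f n)) \<longlonglongrightarrow> p \<and> (\<lambda>n. T (f n)) \<longlonglongrightarrow> w \<and> P (y - p) = 0)"
  have HI: "H y w" if "(\<lambda>n. P (f n)) \<longlonglongrightarrow> p" "(\<lambda>n. T (f n)) \<longlonglongrightarrow> w" "P (y - p) = 0" for f p y w
    unfolding H_def using that by (intro exI[of _ f] exI[of _ p]) simp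
  have H_ex: "\<exists>w. H y w" for y
  proof -
    have "subspace (closure (range P))"
      unfolding subspace_def
    proof (intro conjI ballI allI)
      show "0 \<in> closure (range P)"
        using P.zero closure_subset by (metis rangeI subsetD)
    next
      fix a b assume "a \<in> closure (range P)" "b \<in> closure (range P)"
      then obtain f g where "\<And>n. f n \<in> range P" "f \<longlonglongrightarrow> a" "\<And>n. g n \<in> range P" "g \<longlonglongrightarrow> b"
        by (meson closure_sequential)
      moreover from this have "f n + g n \<in> range P" for n
        by (metis (mono_tags, lifting) P.add rangeE rangeI)
      ultimately show "a + b \<in> closure (range P)"
        unfolding closure_sequential using tendsto_add by fast
    next
      fix c :: real and a assume "a \<in> closure (range P)"
      then obtain f where "\<And>n. f n \<in> range P" "f \<longlonglongrightarrow> a"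
        by (meson closure_sequential)
      moreover from this have "c *\<^sub>R f n \<in> range P" for n
        by (metis (mono_tags, lifting) P.scaleR rangeE rangeI)
      ultimately show "c *\<^sub>R a \<in> closure (range P)"
        unfolding closure_sequential using tendsto_scaleR[OF tendsto_const] by fast
    qed
    then obtain p where p: "p \<in> closure (range P)" "\<And>s. s \<in> closure (range P) \<Longrightarrow> (y - p) \<bullet> s = 0"
      using orthogonal_projection_exists[of "closure (range P)" y] by auto
    obtain f where f: "(\<lambda>n. P (f n)) \<longlonglongrightarrow> p"
    proof -
      obtain g where g: "\<And>n. g n \<in> range P" "g \<longlonglongrightarrow> p"
        using p(1) by (meson closure_sequential)
      then have "\<exists>x. g n = P x" for n by blast
      then obtain f where "\<And>n. g n = P (f n)" by metis
      then have "g = (\<lambda>n. P (f n))" by auto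
      with g(2) that show ?thesis by blast
    qed
    \<comment> \<open>\<open>P\<close> and \<open>T\<close> have equal norms pointwise, so
      convergence of \<open>P (f n)\<close> makes \<open>T (f n)\<close> Cauchy.\<close>
    have "dist (T (f m)) (T (f n)) = dist (P (f m)) (P (f n))" for m n
      by (simp add: dist_norm norm_P flip: T.diff P.diff)
    then have "Cauchy (\<lambda>n. T (f n))"
      using LIMSEQ_imp_Cauchy[OF f] by (simp add: Cauchy_def)
    then obtain w where w: "(\<lambda>n. T (f n)) \<longlonglongrightarrow> w"
      using Cauchy_convergent_iff convergent_def by blast
    have "(y - p) \<bullet> P (P (y - p)) = 0"
      by (rule p(2)[OF subsetD[OF closure_subset rangeI]])
    then have "P (y - p) = 0"
      using P_sym[of "y - p" "P (y - p)"] by simp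
    with HI[OF f w] show ?thesis by blast
  qed
  have H_add: "H (y + z) (v + w)" if "H y v" "H z w" for y z v w
  proof -
    obtain f p where f: "(\<lambda>n. P (f n)) \<longlonglongrightarrow> p" "(\<lambda>n. T (f n)) \<longlonglongrightarrow> v" "P (y - p) = 0"
      using \<open>H y v\<close> unfolding H_def by blast
    obtain g q where g: "(\<lambda>n. P (g n)) \<longlonglongrightarrow> q" "(\<lambda>n. T (g n)) \<longlonglongrightarrow> w" "P (z - q) = 0"
      using \<open>H z w\<close> unfolding H_def by blast
    have "(\<lambda>n. P (f n + g n)) \<longlonglongrightarrow> p + q" "(\<lambda>n. T (f n + g n)) \<longlonglongrightarrow> v + w"
      unfolding P.add T.add by (intro tendsto_add f g)+
    moreover have "P (y + z - (p + q)) = 0"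
      using f(3) g(3) by (simp add: P.add P.diff)
    ultimately show ?thesis by (rule HI)
  qed
  have H_scaleC: "H (c *\<^sub>C y) (c *\<^sub>C w)" if "H y w" for c y w
  proof -
    obtain f p where f: "(\<lambda>n. P (f n)) \<longlonglongrightarrow> p" "(\<lambda>n. T (f n)) \<longlonglongrightarrow> w" "P (y - p) = 0"
      using \<open>H y w\<close> unfolding H_def by blast
    have "(\<lambda>n. P (c *\<^sub>C f n)) \<longlonglongrightarrow> c *\<^sub>C p" "(\<lambda>n. T (c *\<^sub>C f n)) \<longlonglongrightarrow> c *\<^sub>C w"
      unfolding bounded_clinearD(2)[OF PC] bounded_clinearD(2)[OF T]
      by (intro bounded_linear.tendsto[OF bounded_linear_scaleC] f)+
    moreover have "P (c *\<^sub>C y - c *\<^sub>C p) = 0"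
      using f(3) by (simp add: P.diff bounded_clinearD(2)[OF PC])
    ultimately show ?thesis by (rule HI)
  qed
  \<comment> \<open>Here \<open>p\<close> is the component of \<open>y\<close> orthogonal to the
    kernel of \<open>P\<close>. The contraction bound, the null space and the isometry property of
    \<open>U\<close> all follow from this splitting.\<close>
  have H_split: "\<exists>p. norm w = norm p \<and> P (y - p) = 0 \<and> (\<forall>z. P z = 0 \<longrightarrow> p \<bullet> z = 0)" if "H y w" for y w
  proof -
    obtain f p where f: "(\<lambda>n. P (f n)) \<longlonglongrightarrow> p" "(\<lambda>n. T (f n)) \<longlonglongrightarrow> w" "P (y - p) = 0"
      using \<open>H y w\<close> unfolding H_def by blast
    have "norm w = norm p"
      using tendsto_norm[OF f(1)] tendsto_norm[OF f(2)] unfolding norm_P by (rule LIMSEQ_unique[rotated])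
    moreover have "p \<bullet> z = 0" if "P z = 0" for z
    proof (rule LIMSEQ_unique)
      show "(\<lambda>n. P (f n) \<bullet> z) \<longlonglongrightarrow> p \<bullet> z" by (intro tendsto_intros f)
      show "(\<lambda>n. P (f n) \<bullet> z) \<longlonglongrightarrow> 0" by (simp add: P_sym that)
    qed
    ultimately show ?thesis using f(3) by blast
  qed
  have H_norm: "norm w \<le> norm y" if "H y w" for y w
  proof -
    obtain p where p: "norm w = norm p" "p \<bullet> (y - p) = 0"
      using H_split[OF \<open>H y w\<close>] by blast
    have "norm p * norm p = p \<bullet> y"
      using p(2) by (simp add: inner_diff dot_square_norm power2_eq_square)
    also have "\<dots> \<le> norm y * norm p"
      using norm_cauchy_schwarz[of p y] by (simp add: mult.commute)
    finally show ?thesis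
      unfolding p(1) by (cases "p = 0") auto
  qed
  have H_unique: "v = w" if "H y v" "H y w" for y v w
  proof -
    have neg: "(-1) *\<^sub>C x = - x" for x :: 'a
      using scaleR_scaleC[of "-1" x] by simp
    have "H (y + - y) (v + - w)"
      using H_add[OF that(1) H_scaleC[OF that(2), of "-1"]] by (simp add: neg)
    \<comment> \<open>The difference \<open>v - w\<close> is related to 0, so its norm is at most
      0.\<close>
    then show ?thesis using H_norm by fastforce
  qed
  obtain U where U: "\<And>y. H y (U y)"
    using H_ex by metis
  have norm_U: "norm (U y) \<le> norm y" for y
    using H_norm U by blast
  have UC: "bounded_clinear U"
    unfolding bounded_clinear_def
  proof (intro conjI allI)
    show UC: "U (c *\<^sub>C y) = c *\<^sub>C U y" for c y
      using H_unique U H_scaleC by blast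
    show "bounded_linear U"
    proof (rule bounded_linear_intro[where K = 1])
      show "U (x + y) = U x + U y" for x y
        using H_unique U H_add by blast
    qed (simp_all add: UC scaleR_scaleC norm_U)
  qed
  have U_P: "U (P x) = T x" for x
  proof -
    have "H (P x) (T x)"
      by (rule HI[of "\<lambda>_. x" "P x"]) simp_all
    then show ?thesis using U H_unique by blast
  qed
  have U_null: "U y = 0 \<longleftrightarrow> T y = 0" for y
  proof -
    obtain p where p: "norm (U y) = norm p" "P (y - p) = 0" "\<And>z. P z = 0 \<Longrightarrow> p \<bullet> z = 0"
      using H_split[OF U] by blast
    have "U y = 0 \<longleftrightarrow> p = 0" using p(1) by (metis norm_eq_zero)
    also have "\<dots> \<longleftrightarrow> P y = 0"
      using p(2,3)
      by (metis P.diff P.zero diff_zero inner_eq_zero_iff right_minus_eq)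
    finally show ?thesis by (simp add: P_eq_0)
  qed
  have U_pi: "partial_isometry U"
    unfolding partial_isometry_def
  proof (intro conjI allI impI UC)
    fix x assume x: "\<forall>y\<in>null_space U. cinner x y = 0"
    obtain p where p: "norm (U x) = norm p" "P (x - p) = 0" "\<And>z. P z = 0 \<Longrightarrow> p \<bullet> z = 0"
      using H_split[OF U] by blast
    have "x - p \<in> null_space U"
      using p(2) by (simp add: null_space_def U_null P_eq_0)
    then have "x \<bullet> (x - p) = 0"
      using x by (simp add: inner_eq_Re_cinner)
    moreover have "p \<bullet> (x - p) = 0" using p by blast
    ultimately have "(x - p) \<bullet> (x - p) = 0" by (simp only: inner_diff_left)
    then show "norm (U x) = norm x" using p(1) by simp
  qed
  have "polar_isometry T = U"
    unfolding polar_isometry_def P_def[symmetric]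
  proof (rule the_equality)
    show "partial_isometry U \<and> T = U \<circ> P \<and> null_space U = null_space T"
      using U_pi U_P U_null by (auto simp: null_space_def)
    \<comment> \<open>On the range of \<open>P\<close> both maps are fixed by \<open>T\<close>,
      continuity extends this to \<open>p\<close>, and both vanish on \<open>y - p\<close>, which
      lies in the common null space.\<close>
    show "V = U" if V: "partial_isometry V \<and> T = V \<circ> P \<and> null_space V = null_space T" for V
    proof
      fix y
      interpret V: bounded_linear V
        using V by (simp add: partial_isometry_def bounded_clinear_def)
      have V_P: "V (P x) = T x" for x using V by (metis comp_apply)
      obtain f p where f: "(\<lambda>n. P (f n)) \<longlonglongrightarrow> p" "(\<lambda>n. T (f n)) \<longlonglongrightarrow> U y" "P (y - p) = 0"
        using U[of y] unfolding H_def by blast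
      have "y - p \<in> null_space T"
        using f(3) by (simp add: P_eq_0 null_space_def)
      then have "y - p \<in> null_space V"
        using V by blast
      then have "V (y - p) = 0"
        by (simp add: null_space_def)
      moreover have "V p = U y"
        using V.tendsto[OF f(1)] f(2) unfolding V_P by (rule LIMSEQ_unique)
      ultimately show "V y = U y" by (simp add: V.diff)
    qed
  qed
  with UC U_P norm_U show "bounded_clinear (polar_isometry T)"
    "polar_isometry T (abs_op T x) = T x" "norm (polar_isometry T x) \<le> norm x"
    by (simp_all add: P_def)
qed

subsection \<open>Spectra\<close>

lemma spectrum_iff:
  "z \<notin> spectrum T \<longleftrightarrow> (\<exists>S. bounded_clinear S \<and>
    (\<forall>x. S (T x - z *\<^sub>C x) = x) \<and> (\<forall>x. T (S x) - z *\<^sub>C S x = x))"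
  by (simp add: spectrum_def fun_eq_iff)

text \<open>If |z| exceeds ||T||, then \<open>T - z\<close> is bounded below by |z| - ||T||, giving
  injectivity and a bounded inverse. Surjectivity comes from the Banach fixed point theorem.\<close>

lemma norm_le_onorm_of_spectrum:
  fixes T :: "'a::chilbert_space \<Rightarrow> 'a"
  assumes T: "bounded_clinear T" and "z \<in> spectrum T"
  shows "cmod z \<le> onorm T"
proof (rule ccontr)
  note bl = bounded_clinearD(1)[OF T] and TC = bounded_clinearD(2)[OF T]
  interpret bounded_linear T by (rule bl)
  assume "\<not> ?thesis"
  then have less: "onorm T < cmod z" by simp
  then have "z \<noteq> 0" using onorm_pos_le[OF bl] by auto
  define d where "d = cmod z - onorm T"
  have "d > 0" using less by (simp add: d_def)
  define K where "K = (\<lambda>x. T x - z *\<^sub>C x)"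
  have K: "bounded_linear K"
    unfolding K_def by (intro bounded_linear_sub bl bounded_linear_scaleC)
  interpret K: bounded_linear K by (rule K)
  have KC: "K (c *\<^sub>C x) = c *\<^sub>C K x" for c x
    by (simp add: K_def TC scaleC_scaleC scaleC_diff_right mult.commute)
  have lower: "d * norm x \<le> norm (K x)" for x
  proof -
    have "norm (z *\<^sub>C x) \<le> norm (T x) + norm (K x)"
      using norm_triangle_ineq4[of "T x" "K x"] by (simp add: K_def)
    moreover have "norm (T x) \<le> onorm T * norm x" by (rule onorm[OF bl])
    ultimately show ?thesis by (simp add: d_def norm_scaleC algebra_simps)
  qed
  have inj: "x = y" if "K x = K y" for x y
    using lower[of "x - y"] that \<open>d > 0\<close> by (simp add: K.diff mult_le_0_iff)
  have "\<exists>x. K x = y" for y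
  proof -
    \<comment> \<open>Fixed points of this map are the solutions of \<open>K x = y\<close>; its
      Lipschitz constant is ||T|| / |z| < 1.\<close>
    have "\<exists>!x. inverse z *\<^sub>C (T x - y) = x"
    proof (rule banach_fix_type)
      show "0 \<le> onorm T / cmod z" "onorm T / cmod z < 1"
        using onorm_pos_le[OF bl] less \<open>z \<noteq> 0\<close> by (simp_all add: divide_less_eq)
      show "\<forall>a b. dist (inverse z *\<^sub>C (T a - y)) (inverse z *\<^sub>C (T b - y)) \<le> onorm T / cmod z * dist a b"
      proof (intro allI)
        fix a b
        have "dist (inverse z *\<^sub>C (T a - y)) (inverse z *\<^sub>C (T b - y)) = norm (T (a - b)) / cmod z"
          by (simp add: dist_norm norm_scaleC norm_inverse divide_inverse_commute
              flip: scaleC_diff_right diff)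
        also have "\<dots> \<le> onorm T * norm (a - b) / cmod z"
          by (intro divide_right_mono onorm bl) simp
        finally show "dist (inverse z *\<^sub>C (T a - y)) (inverse z *\<^sub>C (T b - y))
            \<le> onorm T / cmod z * dist a b"
          by (simp add: dist_norm)
      qed
    qed
    then obtain x where "inverse z *\<^sub>C (T x - y) = x" by blast
    then have "z *\<^sub>C x = z *\<^sub>C inverse z *\<^sub>C (T x - y)" by simp
    also have "\<dots> = T x - y" using \<open>z \<noteq> 0\<close> by (simp add: scaleC_scaleC scaleC_one)
    finally have "K x = y" by (simp add: K_def)
    then show ?thesis ..
  qed
  then obtain S where KS: "\<And>y. K (S y) = y" by metis
  have SK: "S (K x) = x" for x by (rule inj) (rule KS)
  have SC: "S (c *\<^sub>C x) = c *\<^sub>C S x" for c x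
    by (rule inj) (simp add: KS KC)
  have "bounded_linear S"
  proof (rule bounded_linear_intro)
    show "S (x + y) = S x + S y" for x y by (rule inj) (simp add: KS K.add)
    show "S (r *\<^sub>R x) = r *\<^sub>R S x" for r x by (simp add: scaleR_scaleC SC)
    show "norm (S x) \<le> norm x * inverse d" for x
      using lower[of "S x"] \<open>d > 0\<close> by (simp add: KS field_simps)
  qed
  with SC have "bounded_clinear S" by (simp add: bounded_clinear_def)
  with SK KS have "z \<notin> spectrum T" unfolding spectrum_iff K_def by blast
  with assms(2) show False by blast
qed

lemma spectrum_comp_commute:
  assumes A: "bounded_clinear A" and B: "bounded_clinear B"
    and z: "z \<in> spectrum (\<lambda>x. A (B x))" "z \<noteq> 0"
  shows "z \<in> spectrum (\<lambda>x. B (A x))"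
proof (rule ccontr)
  note bl = bounded_clinearD(1)[OF A] bounded_clinearD(1)[OF B]
  note AC = bounded_clinearD(2)[OF A] and BC = bounded_clinearD(2)[OF B]
  interpret A: bounded_linear A by (rule bl)
  interpret B: bounded_linear B by (rule bl)
  assume "z \<notin> spectrum (\<lambda>x. B (A x))"
  then obtain S where S: "bounded_clinear S" "\<And>x. S (B (A x) - z *\<^sub>C x) = x"
    "\<And>x. B (A (S x)) - z *\<^sub>C S x = x"
    unfolding spectrum_iff by blast
  note SC = bounded_clinearD(2)[OF S(1)]
  interpret S: bounded_linear S using S(1) by (rule bounded_clinearD)
  \<comment> \<open>The resolvent identity (AB - z)^-1 = z^-1 (A (BA - z)^-1 B - 1).\<close>
  define R where "R = (\<lambda>x. inverse z *\<^sub>C (A (S (B x)) - x))"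
  have "bounded_clinear R"
    unfolding bounded_clinear_def
  proof (intro conjI allI)
    show "bounded_linear R"
      unfolding R_def
      by (intro bounded_linear_compose[OF bounded_linear_scaleC] bounded_linear_sub
          bounded_linear_compose[OF bl(1)] bounded_linear_compose[OF S.bounded_linear_axioms]
          bl bounded_linear_ident)
    show "R (c *\<^sub>C x) = c *\<^sub>C R x" for c x
      by (simp add: R_def AC BC SC scaleC_diff_right scaleC_scaleC mult.commute)
  qed
  moreover have "R (A (B x) - z *\<^sub>C x) = x" for x
  proof -
    have "S (B (A (B x) - z *\<^sub>C x)) = B x"
      using S(2)[of "B x"] by (simp add: B.diff BC)
    then show ?thesis
      using z(2) by (simp add: R_def scaleC_scaleC scaleC_one)
  qed
  moreover have "A (B (R x)) - z *\<^sub>C R x = x" for x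
  proof -
    have "A (B (A (S (B x)))) = A (z *\<^sub>C S (B x) + B x)"
      using S(3)[of "B x"] by (simp add: algebra_simps)
    moreover define w where "w = A (S (B x)) - x"
    ultimately have "A (B w) - z *\<^sub>C w = z *\<^sub>C x"
      by (simp add: A.diff B.diff A.add AC scaleC_diff_right)
    then have "inverse z *\<^sub>C (A (B w) - z *\<^sub>C w) = x"
      using z(2) by (simp add: scaleC_scaleC scaleC_one)
    moreover have "R x = inverse z *\<^sub>C w"
      by (simp add: R_def w_def)
    ultimately show ?thesis
      by (simp add: AC BC scaleC_diff_right scaleC_scaleC mult.commute)
  qed
  ultimately have "z \<notin> spectrum (\<lambda>x. A (B x))"
    unfolding spectrum_iff by blast
  with z(1) show False by blast
qed

subsection \<open>The mean transform\<close>

theorem theorem3p2: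
  fixes T :: "'a::chilbert_space \<Rightarrow> 'a" and l :: real
  assumes "bounded_clinear T" and "l \<in> {0..1}"
  shows "(2 * sqrt (l - l\<^sup>2) * onorm (aluthge T) \<le> onorm (mean_transform l T) \<and>
      onorm (mean_transform l T) \<le> l * onorm T + (1 - l) * onorm (duggal T)) \<and>
    (2 * sqrt (l - l\<^sup>2) * spectral_radius T \<le> onorm (mean_transform l T) \<and>
      onorm (mean_transform l T) \<le> onorm T)"
proof -
  define P where "P = abs_op T"
  define R where "R = sqrt_op P"
  define U where "U = polar_isometry T"
  have l: "0 \<le> l" "l \<le> 1" using assms(2) by auto
  have P: "positive_op P" unfolding P_def by (rule positive_op_abs_op[OF assms(1)])
  have R: "positive_op R" and RR: "R (R x) = P x" for x
    unfolding R_def by (rule positive_op_sqrt_op[OF P], rule sqrt_op_sqrt_op[OF P])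
  have U: "bounded_clinear U" and UP: "U (P x) = T x" and norm_U: "norm (U x) \<le> norm x" for x
    unfolding U_def P_def using assms(1)
    by (simp_all add: bounded_clinear_polar_isometry polar_isometry_abs_op norm_polar_isometry_le)
  have PC: "bounded_clinear P" and RC: "bounded_clinear R" and R_psd: "psd_op R"
    using P R by (auto simp: positive_op_iff_psd_op)
  note bl = bounded_clinearD(1)[OF PC] bounded_clinearD(1)[OF RC] bounded_clinearD(1)[OF U]
    bounded_clinearD(1)[OF assms(1)]
  note comp = bounded_linear_compose
  interpret R: bounded_linear R by (rule bl)
  interpret U: bounded_linear U by (rule bl)
  have duggal: "duggal T = (\<lambda>x. P (U x))"
    by (simp add: duggal_def P_def U_def comp_def)
  have aluthge: "aluthge T = (\<lambda>x. R (U (R x)))"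
    by (simp add: aluthge_def P_def R_def U_def comp_def)
  have duggal_bl: "bounded_linear (duggal T)"
    unfolding duggal by (rule comp[OF bl(1,3)])
  have UR: "bounded_clinear (\<lambda>x. U (R x))"
    by (rule bounded_clinear_compose[OF U RC])
  have aluthge_bl: "bounded_clinear (aluthge T)"
    unfolding aluthge by (rule bounded_clinear_compose[OF RC UR])
  have onorm_duggal: "onorm (duggal T) \<le> onorm T"
  proof (rule onorm_bound[OF onorm_pos_le[OF bl(4)]])
    fix x
    have "norm (duggal T x) = norm (T (U x))"
      by (simp add: duggal P_def norm_abs_op[OF assms(1)])
    also have "\<dots> \<le> onorm T * norm (U x)" by (rule onorm[OF bl(4)])
    also have "\<dots> \<le> onorm T * norm x"
      by (intro mult_left_mono norm_U onorm_pos_le bl(4))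
    finally show "norm (duggal T x) \<le> onorm T * norm x" .
  qed
  have upper: "onorm (mean_transform l T) \<le> l * onorm T + (1 - l) * onorm (duggal T)"
    unfolding mean_transform_def
    using onorm_triangle[OF bounded_linear_const_scaleR[OF bl(4), of l]
        bounded_linear_const_scaleR[OF duggal_bl, of "1 - l"]] l
    by (simp add: onorm_scaleR[OF bl(4)] onorm_scaleR[OF duggal_bl])
  also have "\<dots> \<le> l * onorm T + (1 - l) * onorm T"
    using l onorm_duggal by (intro add_left_mono mult_left_mono) auto
  finally have upper': "onorm (mean_transform l T) \<le> onorm T"
    by (simp add: algebra_simps)
  define A where "A = (\<lambda>x. sqrt (1 - l) *\<^sub>R R x)"
  define B where "B = (\<lambda>x. sqrt l *\<^sub>R R x)"
  have A: "psd_op A" and B: "psd_op B"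
    unfolding A_def B_def using l by (auto intro!: psd_op_scaleR R_psd)
  have "2 * onorm (\<lambda>x. A (U (B x))) \<le> onorm (\<lambda>x. A (A (U x)) + U (B (B x)))"
    by (rule operator_am_gm) (use A B bl(3) in \<open>auto simp: psd_opD\<close>)
  also have "(\<lambda>x. A (A (U x)) + U (B (B x))) = mean_transform l T"
    using l by (simp add: A_def B_def mean_transform_def duggal R.scaleR U.scaleR RR UP
        add.commute flip: mult.assoc)
  also have "(\<lambda>x. A (U (B x))) = (\<lambda>x. sqrt (l - l\<^sup>2) *\<^sub>R aluthge T x)"
    by (simp add: A_def B_def aluthge R.scaleR U.scaleR power2_eq_square algebra_simps
        flip: real_sqrt_mult)
  also have "onorm \<dots> = sqrt (l - l\<^sup>2) * onorm (aluthge T)"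
    using l by (simp add: onorm_scaleR[OF bounded_clinearD(1)[OF aluthge_bl]] power2_eq_square
        mult_left_le)
  finally have lower: "2 * sqrt (l - l\<^sup>2) * onorm (aluthge T) \<le> onorm (mean_transform l T)"
    by (simp add: mult.assoc)
  have spectrum_le: "cmod z \<le> onorm (aluthge T)" if "z \<in> spectrum T" for z
  \<comment> \<open>Exchanging factors preserves only the nonzero spectrum, so 0 is treated
    separately.\<close>
  proof (cases "z = 0")
    case True
    then show ?thesis
      using onorm_pos_le[OF bounded_clinearD(1)[OF aluthge_bl]] by simp
  next
    case False
    have "z \<in> spectrum (\<lambda>x. U (R (R x)))"
      using that by (simp add: RR UP)
    then have "z \<in> spectrum (aluthge T)"
      unfolding aluthge using spectrum_comp_commute[OF UR RC] False by blast
    then show ?thesis by (rule norm_le_onorm_of_spectrum[OF aluthge_bl])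
  qed
  \<comment> \<open>For empty spectrum the default value 0 is covered by nonnegativity of the
    norm.\<close>
  have "spectral_radius T \<le> onorm (aluthge T)"
    unfolding spectral_radius_def
    using spectrum_le onorm_pos_le[OF bounded_clinearD(1)[OF aluthge_bl]]
    by (auto intro: cSUP_least)
  then have "2 * sqrt (l - l\<^sup>2) * spectral_radius T \<le> 2 * sqrt (l - l\<^sup>2) * onorm (aluthge T)"
    using l by (intro mult_left_mono) (simp_all add: power2_eq_square mult_left_le)
  with lower upper upper' show ?thesis by linarith
qed

end
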